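(* Let $m \geq 1$ and let $\{x_1, \dots, x_m\} \subset [0,1]$ be an arbitrary initial set. For every $N > m$, let $x_N \in [0,1]$ be chosen (greedily) as $$ x_N \in \arg\min_{\substack{x \in [0,1] \\ \min_{1 \leq k \leq N-1} |x-x_k| \geq N^{-10}}} \sum_{k=1}^{N-1}\left(1-\log\left(2\sin\left(\pi |x-x_k|\right)\right)\right),$$ where, if the minimizer is not unique, any minimizer may be chosen. Then there is a constant $C>0$ depending only on the initial set $\{x_1,\dots,x_m\}$ such that for all $N \geq 2$, $$ D_N^* \leq C\,\frac{\log N}{\sqrt{N}}.$$
   Context: For a sequence $(x_n)_{n=1}^{\infty}$ in $[0,1]$, the star discrepancy of its first $N$ elements is $$ D_N^* = \sup_{0 \leq x \leq 1} \left| \frac{\#\{1 \leq i \leq N : x_i \leq x\}}{N} - x \right|.$$ *)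

theory Defs
  imports "HOL-Analysis.Analysis"
begin

text \<open>Sequences are functions on \<^typ>\<open>nat\<close> indexed from 1; the value at 0 is never used.\<close>

definition star_discrepancy :: "(nat \<Rightarrow> real) \<Rightarrow> nat \<Rightarrow> real" where
  "star_discrepancy x N =
     (SUP t\<in>{0..1}. \<bar>real (card {i \<in> {1..N}. x i \<le> t}) / real N - t\<bar>)"

text \<open>Since \<^prop>\<open>ln (0::real) = 0\<close>, the usual convention \<open>log 0 = -\<infinity>\<close> has to be made explicit. It
  matters when \<open>\<bar>t - x k\<bar> = 1\<close>: the energy there is \<open>+\<infinity>\<close>, so such a point \<open>t\<close> is never a
  minimizer.\<close>

definition ext_ln :: "real \<Rightarrow> ereal" where
  "ext_ln y = (if y > 0 then ereal (ln y) else -\<infinity>)"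

definition energy :: "(nat \<Rightarrow> real) \<Rightarrow> nat \<Rightarrow> real \<Rightarrow> ereal" where
  "energy x N t = (\<Sum>k\<in>{1..<N}. 1 - ext_ln (2 * sin (pi * \<bar>t - x k\<bar>)))"

definition admissible :: "(nat \<Rightarrow> real) \<Rightarrow> nat \<Rightarrow> real \<Rightarrow> bool" where
  "admissible x N t \<longleftrightarrow>
     t \<in> {0..1} \<and> (MIN k\<in>{1..<N}. \<bar>t - x k\<bar>) \<ge> 1 / real N ^ 10"

definition greedy_from :: "nat \<Rightarrow> (nat \<Rightarrow> real) \<Rightarrow> bool" where
  "greedy_from m x \<longleftrightarrow> (\<forall>N>m. is_arg_min (energy x N) (admissible x N) (x N))"

end

theory Submission
  imports Defs
begin

text \<open>
  Write \<open>S k\<close> for the exponential sum \<open>\<Sum>i\<le>N. e(k x\<^sub>i)\<close>. The polynomial \<open>\<Prod>k<N. (1 - z e(-x\<^sub>k))\<close> has mean 1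
  over suitable \<open>N\<close> equally spaced admissible points, so the minimal value of \<open>\<Sum>k<N. - ln |1 - e(x - x\<^sub>k)|\<close>
  is at most 0. Summing over the greedy steps bounds the logarithmic energy of the point set. After
  regularising \<open>- ln |1 - e(t)|\<close> to \<open>- ln |1 - r e(t)| = \<Sum>k. r^k cos(2\<pi>kt) / k\<close> with \<open>r = 1 - 1/(2N)\<close>, the
  diagonal contributes only \<open>N ln (2N)\<close>, whence \<open>\<Sum>k\<le>N. |S k|\<^sup>2 / k = O(N ln N)\<close>, and
  \<open>\<Sum>k\<le>N. |S k| / k = O(\<surd>N ln N)\<close> by Cauchy-Schwarz. Finally the indicator function of an interval is
  majorised by a trapezoid with ramps of length \<open>1/\<surd>N\<close>, whose Fourier coefficients decay fast enough to
  truncate its expansion at frequency \<open>N\<close>.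
\<close>

section \<open>The logarithmic kernel\<close>

text \<open>Real part of the Taylor series of \<open>- ln (1 - z)\<close> at
  \<open>z = r * cis t\<close>. The term \<open>k = 0\<close> is 0 because division by zero yields
  0.\<close>

lemma log_kernel_sums:
  assumes "0 \<le> r" "r < 1"
  shows "(\<lambda>k. r ^ k / real k * cos (real k * t)) sums (- ln (cmod (1 - of_real r * cis t)))"
proof -
  define z where "z = of_real r * cis t"
  have z: "cmod z < 1" using assms by (simp add: z_def norm_mult)
  have "(\<lambda>n. - ((- (- z)) ^ n) / of_nat n) sums ln (1 + - z)"
    by (rule Ln_series') (use z in simp)
  then have "(\<lambda>n. - (z ^ n / of_nat n)) sums ln (1 - z)" by simp
  then have sums: "(\<lambda>n. Re (z ^ n / of_nat n)) sums - Re (ln (1 - z))"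
    using sums_minus[OF sums_Re] by fastforce
  have eq: "Re (z ^ n / of_nat n) = r ^ n / real n * cos (real n * t)" for n
  proof -
    have "z ^ n = of_real (r ^ n) * cis (real n * t)" by (simp add: z_def power_mult_distrib Complex.DeMoivre)
    then have "z ^ n / of_nat n = of_real (r ^ n / real n) * cis (real n * t)" by simp
    then show ?thesis by (simp only: scaleR_conv_of_real[symmetric] scaleR_complex.sel cis.sel)
  qed
  have "1 - z \<noteq> 0" using z by force
  then have "Re (ln (1 - z)) = ln (cmod (1 - z))" by simp
  then show ?thesis using sums unfolding eq by (simp add: z_def)
qed

lemma norm_sum_cis_squared:
  "(cmod (\<Sum>i\<in>I. cis (f i)))\<^sup>2 = (\<Sum>i\<in>I. \<Sum>j\<in>I. cos (f i - f j))"
proof -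
  have "(cmod (\<Sum>i\<in>I. cis (f i)))\<^sup>2 = Re ((\<Sum>i\<in>I. cis (f i)) * cnj (\<Sum>i\<in>I. cis (f i)))"
    by (simp only: complex_norm_square[symmetric]) simp
  also have "\<dots> = (\<Sum>i\<in>I. \<Sum>j\<in>I. cos (f i - f j))"
    by (simp add: sum_product cis_cnj cis_mult del: of_nat_sum)
  finally show ?thesis .
qed

text \<open>Expanding the kernel for every pair and summing over the pairs first turns the cosines
  at frequency \<open>k\<close> into a squared modulus. All terms are then nonnegative, so
  truncating the series at \<open>K\<close> can only lower it.\<close>

lemma exponential_sums_le_energy:
  assumes r: "0 \<le> r" "r < 1"
  shows "(\<Sum>k=1..K. r ^ k / real k * (cmod (\<Sum>i\<in>I. cis (real k * y i)))\<^sup>2)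
          \<le> (\<Sum>i\<in>I. \<Sum>j\<in>I. - ln (cmod (1 - of_real r * cis (y i - y j))))"
proof -
  define g where "g = (\<lambda>k. r ^ k / real k * (cmod (\<Sum>i\<in>I. cis (real k * y i)))\<^sup>2)"
  have "(\<lambda>k. \<Sum>i\<in>I. \<Sum>j\<in>I. r ^ k / real k * cos (real k * (y i - y j)))
      sums (\<Sum>i\<in>I. \<Sum>j\<in>I. - ln (cmod (1 - of_real r * cis (y i - y j))))"
    by (intro sums_sum log_kernel_sums r)
  moreover have "(\<Sum>i\<in>I. \<Sum>j\<in>I. r ^ k / real k * cos (real k * (y i - y j)))
      = r ^ k / real k * (cmod (\<Sum>i\<in>I. cis (real k * y i)))\<^sup>2" for k
    by (simp add: norm_sum_cis_squared sum_distrib_left right_diff_distrib)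
  ultimately have "(\<lambda>k. r ^ k / real k * (cmod (\<Sum>i\<in>I. cis (real k * y i)))\<^sup>2)
      sums (\<Sum>i\<in>I. \<Sum>j\<in>I. - ln (cmod (1 - of_real r * cis (y i - y j))))"
    by simp
  then have sums: "g sums (\<Sum>i\<in>I. \<Sum>j\<in>I. - ln (cmod (1 - of_real r * cis (y i - y j))))"
    unfolding g_def .
  have "sum g {1..K} \<le> suminf g"
    using sums r by (intro sum_le_suminf) (auto simp: sums_iff g_def)
  then show ?thesis using sums by (simp only: sums_iff g_def)
qed

lemma cmod_one_minus_cis: "cmod (1 - cis t) = 2 * \<bar>sin (t/2)\<bar>"
proof -
  have "(cmod (1 - cis t))\<^sup>2 = (1 - cos t)\<^sup>2 + (sin t)\<^sup>2" by (simp add: cmod_def)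
  also have "\<dots> = 2 - 2 * cos (2 * (t/2))"
    using sin_cos_squared_add[of t] by (simp add: power2_eq_square algebra_simps)
  also have "\<dots> = (2 * \<bar>sin (t/2)\<bar>)\<^sup>2" by (simp only: cos_double_sin power_mult_distrib power2_abs) simp
  finally show ?thesis by (metis abs_ge_zero mult_nonneg_nonneg norm_ge_zero power2_eq_imp_eq zero_le_numeral)
qed

text \<open>The squares of the two sides of the first inequality differ by exactly
  \<open>(1 - r)^2\<close>. It compares the regularised kernel with the true one off the diagonal;
  the second inequality bounds it everywhere, including the diagonal.\<close>

lemma cmod_one_minus_scaled_cis_ge:
  assumes "0 \<le> r" "r \<le> 1"
  shows "sqrt r * cmod (1 - cis t) \<le> cmod (1 - of_real r * cis t)"
    and "1 - r \<le> cmod (1 - of_real r * cis t)"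
proof -
  have "(cmod (1 - of_real r * cis t))\<^sup>2 = (1 - r * cos t)\<^sup>2 + (r * sin t)\<^sup>2" by (simp add: cmod_def)
  also have "\<dots> = 1 - 2 * r * cos t + r\<^sup>2 * ((sin t)\<^sup>2 + (cos t)\<^sup>2)"
    by algebra
  finally have 1: "(cmod (1 - of_real r * cis t))\<^sup>2 = 1 - 2 * r * cos t + r\<^sup>2" by simp
  have 2: "(cmod (1 - cis t))\<^sup>2 = 2 - 2 * cos t"
    by (simp add: cmod_def) (use sin_cos_squared_add[of t] in \<open>simp add: power2_eq_square algebra_simps\<close>)
  have "(sqrt r * cmod (1 - cis t))\<^sup>2 = r * (2 - 2 * cos t)"
    using assms 2 by (simp add: power_mult_distrib)
  also have "\<dots> \<le> (cmod (1 - of_real r * cis t))\<^sup>2"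
    unfolding 1 using zero_le_power2[of "1 - r"] by (simp add: power2_eq_square algebra_simps)
  finally show "sqrt r * cmod (1 - cis t) \<le> cmod (1 - of_real r * cis t)"
    by (rule power2_le_imp_le) simp
  have "cmod 1 - cmod (of_real r * cis t) \<le> cmod (1 - of_real r * cis t)" by (rule norm_triangle_ineq2)
  then show "1 - r \<le> cmod (1 - of_real r * cis t)" using assms by (simp add: norm_mult)
qed

text \<open>Groups the pairs by their larger index \<open>j\<close>, so that the inner sum is what
  the choice of the \<open>j\<close>-th point controls.\<close>

lemma sum_square_eq_sum_triangle:
  fixes f :: "nat \<Rightarrow> nat \<Rightarrow> real"
  assumes "\<And>i j. f i j = f j i"
  shows "(\<Sum>i=1..n. \<Sum>j=1..n. f i j) = (\<Sum>j=1..n. f j j + 2 * (\<Sum>i\<in>{1..<j}. f i j))"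
proof (induction n)
  case (Suc n)
  have "(\<Sum>j=1..n. f (Suc n) j) = (\<Sum>j=1..n. f j (Suc n))" by (intro sum.cong assms refl)
  moreover have "(\<Sum>i=1..Suc n. \<Sum>j=1..Suc n. f i j)
      = (\<Sum>i=1..n. \<Sum>j=1..n. f i j) + (\<Sum>i=1..n. f i (Suc n)) + (\<Sum>j=1..n. f (Suc n) j) + f (Suc n) (Suc n)"
    by (simp add: sum.distrib)
  moreover have "(\<Sum>j=1..Suc n. f j j + 2 * (\<Sum>i\<in>{1..<j}. f i j))
      = (\<Sum>j=1..n. f j j + 2 * (\<Sum>i\<in>{1..<j}. f i j)) + (f (Suc n) (Suc n) + 2 * (\<Sum>i=1..n. f i (Suc n)))"
    by (simp add: atLeastLessThanSuc_atLeastAtMost)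
  ultimately show ?case using Suc.IH by linarith
qed simp

section \<open>Greedy steps\<close>

text \<open>A full geometric sum whose ratio \<open>w\<close> is an \<open>M\<close>-th root of
  unity; \<open>0 < j < M\<close> guarantees \<open>w\<close> is not 1.\<close>

lemma sum_roots_of_unity_power:
  assumes "0 < j" "j < M"
  shows "(\<Sum>l<M. cis (2 * pi * real l / real M) ^ j) = 0"
proof -
  define w where "w = cis (2 * pi * real j / real M)"
  have "inj_on (\<lambda>k. cis (2 * pi * real k / real M)) {..<M}"
    using Complex.bij_betw_roots_unity[of M] assms by (auto simp: bij_betw_def)
  then have "w \<noteq> cis (2 * pi * real 0 / real M)"
    using assms unfolding w_def by (auto dest!: inj_onD[where x = j and y = 0])
  then have "w \<noteq> 1" by simp
  have "w ^ M = cis (2 * pi * real j)" using assms by (simp add: w_def Complex.DeMoivre)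
  also have "\<dots> = 1" by (metis cis_multiple_2pi Ints_of_nat)
  finally have "w ^ M = 1" .
  have "(\<Sum>l<M. cis (2 * pi * real l / real M) ^ j) = (\<Sum>l<M. w ^ l)"
    by (intro sum.cong) (auto simp: w_def Complex.DeMoivre mult_ac)
  also have "\<dots> = 0" using geometric_sum[OF \<open>w \<noteq> 1\<close>, of M] \<open>w ^ M = 1\<close> by simp
  finally show ?thesis .
qed

text \<open>The mean of the polynomial over the \<open>M\<close> points is its value 1 at the origin.\<close>

lemma exists_large_product:
  assumes I: "finite I" "card I < M"
  shows "\<exists>l<M. 1 \<le> cmod (\<Prod>k\<in>I. 1 - z * cis (2 * pi * real l / real M) * a k)"
proof (rule ccontr)
  assume "\<not> ?thesis"
  then have less: "cmod (\<Prod>k\<in>I. 1 - z * cis (2 * pi * real l / real M) * a k) < 1" if "l < M" for l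
    using that by force
  define p where "p = (\<Prod>k\<in>I. [:1, - a k:])"
  have p: "poly p y = (\<Prod>k\<in>I. 1 - y * a k)" for y
    by (simp add: p_def poly_prod)
  have "degree p \<le> (\<Sum>k\<in>I. degree [:1, - a k:])"
    unfolding p_def using degree_prod_sum_le[OF I(1), of "\<lambda>k. [:1, - a k:]"] by (simp add: o_def)
  also have "\<dots> \<le> (\<Sum>k\<in>I. 1)" by (intro sum_mono) (simp add: degree_pCons_le)
  finally have deg: "degree p < M" using I(2) by simp
  have "(\<Sum>l<M. poly p (z * cis (2 * pi * real l / real M)))
      = (\<Sum>j\<le>degree p. coeff p j * z ^ j * (\<Sum>l<M. cis (2 * pi * real l / real M) ^ j))"
    unfolding poly_altdef sum_distrib_left
    by (subst sum.swap) (simp add: power_mult_distrib mult_ac)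
  \<comment> \<open>Since the degree is below \<open>M\<close>, no exponent but 0 is a multiple of
    \<open>M\<close>, and only the constant coefficient survives.\<close>
  also have "\<dots> = (\<Sum>j\<in>{0}. coeff p j * z ^ j * (\<Sum>l<M. cis (2 * pi * real l / real M) ^ j))"
    using deg by (intro sum.mono_neutral_right) (auto simp: sum_roots_of_unity_power)
  also have "\<dots> = of_nat M" using p[of 0] by (simp add: poly_0_coeff_0)
  finally have eq: "(\<Sum>l<M. poly p (z * cis (2 * pi * real l / real M))) = of_nat M" .
  have "real M = cmod (\<Sum>l<M. poly p (z * cis (2 * pi * real l / real M)))" by (simp add: eq)
  also have "\<dots> \<le> (\<Sum>l<M. cmod (poly p (z * cis (2 * pi * real l / real M))))" by (rule norm_sum)
  also have "\<dots> < (\<Sum>l<M. 1)" using less deg by (intro sum_strict_mono) (auto simp: p)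
  finally show False by simp
qed

text \<open>
  Each \<open>x k\<close> is too close to at most one point of the grid \<open>\<int> / N\<^sup>2\<close>, so it spoils at most one of
  the \<open>N\<close> residue classes.
\<close>

lemma exists_separated_shift:
  fixes x :: "nat \<Rightarrow> real"
  assumes N: "2 \<le> N"
  shows "\<exists>s<N. \<forall>l. \<forall>k\<in>{1..<N}. 1 / real N ^ 10 \<le> \<bar>real (s + N * l) / (real N)\<^sup>2 - x k\<bar>"
proof (rule ccontr)
  assume "\<not> ?thesis"
  then have "\<forall>s\<in>{..<N}. \<exists>l k. k \<in> {1..<N} \<and> \<bar>real (s + N * l) / (real N)\<^sup>2 - x k\<bar> < 1 / real N ^ 10"
    unfolding not_ex not_all ball_simps not_le de_Morgan_conj by (meson lessThan_iff not_less)
  then obtain L K where "\<forall>s\<in>{..<N}. K s \<in> {1..<N} \<and>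
      \<bar>real (s + N * L s) / (real N)\<^sup>2 - x (K s)\<bar> < 1 / real N ^ 10"
    unfolding bchoice_iff by blast
  then have LK: "\<And>s. s < N \<Longrightarrow> K s \<in> {1..<N}"
      "\<And>s. s < N \<Longrightarrow> \<bar>real (s + N * L s) / (real N)\<^sup>2 - x (K s)\<bar> < 1 / real N ^ 10"
    by simp_all
  \<comment> \<open>Two grid points close to the same \<open>x k\<close> are less than
    \<open>2 / N^10\<close> apart, hence less than one grid spacing, so they coincide.\<close>
  have small: "2 * (1 / real N ^ 10) \<le> 1 / (real N)\<^sup>2"
  proof -
    have "(2::real) ^ 8 \<le> real N ^ 8" using N by (intro power_mono) auto
    then have "2 * (real N)\<^sup>2 \<le> real N ^ 8 * (real N)\<^sup>2" by (intro mult_right_mono) auto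
    also have "\<dots> = real N ^ 10" by (simp add: power_add[symmetric])
    finally show ?thesis using N by (simp add: field_simps)
  qed
  have "inj_on K {..<N}"
  proof (rule inj_onI)
    fix s s' assume s: "s \<in> {..<N}" "s' \<in> {..<N}" "K s = K s'"
    have "\<bar>real (s + N * L s) / (real N)\<^sup>2 - real (s' + N * L s') / (real N)\<^sup>2\<bar> < 1 / (real N)\<^sup>2"
      using LK(2)[of s] LK(2)[of s'] s small by auto
    then have "\<bar>real (s + N * L s) - real (s' + N * L s')\<bar> < 1"
      using N by (simp add: diff_divide_distrib[symmetric] abs_divide divide_less_cancel)
    then have "s + N * L s = s' + N * L s'" by linarith
    then have "(s + N * L s) mod N = (s' + N * L s') mod N" by simp
    then show "s = s'" using s by simp
  qed
  \<comment> \<open>Pigeonhole: \<open>N\<close> residue classes against \<open>N - 1\<close>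
    points.\<close>
  then have "card {..<N} \<le> card {1..<N}"
    using LK(1) by (intro card_inj_on_le) auto
  then show False using N by simp
qed

lemma abs_sin_mult_abs: "\<bar>sin (c * \<bar>u\<bar>)\<bar> = \<bar>sin (c * u :: real)\<bar>"
  by (cases "0 \<le> u") auto

text \<open>For a good shift \<open>s\<close>, all the points \<open>s / N^2 + l / N\<close> with
  \<open>l < N\<close> are admissible, so averaging over them may select \<open>l\<close>. The bound
  \<open>N - 1\<close> is the total of the summands 1 in \<open>energy\<close>; the logarithmic part
  is at most 0.\<close>

lemma exists_admissible_nonpositive_potential:
  assumes N: "2 \<le> N" and x: "\<And>k. k \<in> {1..<N} \<Longrightarrow> x k \<in> {0..1}"
  shows "\<exists>y. admissible x N y \<and> energy x N y \<le> ereal (real N - 1)"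
proof -
  obtain s where s: "s < N"
      "\<And>l k. k \<in> {1..<N} \<Longrightarrow> 1 / real N ^ 10 \<le> \<bar>real (s + N * l) / (real N)\<^sup>2 - x k\<bar>"
    using exists_separated_shift[OF N, of x] by blast
  obtain l where l: "l < N" "1 \<le> cmod (\<Prod>k\<in>{1..<N}. 1 - cis (2 * pi * (real s / (real N)\<^sup>2))
      * cis (2 * pi * real l / real N) * cis (- (2 * pi * x k)))"
    using exists_large_product[of "{1..<N}" N "cis (2 * pi * (real s / (real N)\<^sup>2))"
        "\<lambda>k. cis (- (2 * pi * x k))"] N by (simp only: finite_atLeastLessThan card_atLeastLessThan) auto
  define y where "y = real (s + N * l) / (real N)\<^sup>2"
  have y: "y \<in> {0..1}"
  proof -
    have "s + N * l \<le> N * 1 + N * (N - 1)" using s(1) l(1) by (intro add_mono mult_le_mono) auto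
    also have "\<dots> = N\<^sup>2" using N by (cases N) (auto simp: power2_eq_square)
    finally have "real (s + N * l) \<le> (real N)\<^sup>2" by (metis of_nat_le_iff of_nat_power)
    then show ?thesis using N by (simp add: y_def)
  qed
  have adm: "admissible x N y"
    unfolding admissible_def using y s(2) N by (auto simp: y_def)
  have cis: "cis (2 * pi * (real s / (real N)\<^sup>2)) * cis (2 * pi * real l / real N) * cis (- (2 * pi * x k))
      = cis (2 * pi * (y - x k))" for k
    using N by (simp add: cis_mult y_def field_simps power2_eq_square)
  define f where "f = (\<lambda>k. 2 * sin (pi * \<bar>y - x k\<bar>))"
  have f: "cmod (1 - cis (2 * pi * (y - x k))) = f k" if "k \<in> {1..<N}" for k
  proof -
    have "\<bar>y - x k\<bar> \<le> 1" using y x[OF that] by auto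
    then have "sin (pi * \<bar>y - x k\<bar>) \<ge> 0" by (intro sin_ge_zero) auto
    moreover have "\<bar>sin (pi * (y - x k))\<bar> = \<bar>sin (pi * \<bar>y - x k\<bar>)\<bar>" by (rule abs_sin_mult_abs[symmetric])
    ultimately show ?thesis by (simp add: cmod_one_minus_cis f_def)
  qed
  have prod: "1 \<le> prod f {1..<N}"
    using l(2) f unfolding cis by (simp add: prod_norm[symmetric])
  have nonneg: "f k \<ge> 0" if "k \<in> {1..<N}" for k using f[OF that] by (metis norm_ge_zero)
  \<comment> \<open>A product of at least 1 has no zero factor, so every logarithm in the energy is
    finite.\<close>
  have pos: "f k > 0" if "k \<in> {1..<N}" for k
  proof -
    have "f k \<noteq> 0"
    proof
      assume "f k = 0"
      with that have "\<exists>k\<in>{1..<N}. f k = 0" by blast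
      then have "prod f {1..<N} = 0" by (intro prod_zero) auto
      with prod show False by linarith
    qed
    then show ?thesis using nonneg[OF that] by simp
  qed
  have "energy x N y = (\<Sum>k\<in>{1..<N}. ereal (1 - ln (f k)))"
    unfolding energy_def using pos by (intro sum.cong) (auto simp: f_def ext_ln_def one_ereal_def)
  also have "\<dots> = ereal (real N - 1 - ln (prod f {1..<N}))"
  proof -
    have "ln (prod f {1..<N}) = (\<Sum>k\<in>{1..<N}. ln (f k))" by (intro ln_prod) (use pos in force)+
    then show ?thesis using N by (simp add: sum_subtractf of_nat_diff del: One_nat_def)
  qed
  also have "\<dots> \<le> ereal (real N - 1)" using prod by simp
  finally show ?thesis using adm by blast
qed

text \<open>The minimizer does at least as well as the competitor just constructed. Its energy is
  therefore finite, which also excludes coincidences modulo 1 such as the pair 0 and 1.\<close>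

lemma greedy_potential_nonpos:
  assumes N: "2 \<le> N" and x: "\<And>k. k \<in> {1..N} \<Longrightarrow> x k \<in> {0..1}"
    and min: "is_arg_min (energy x N) (admissible x N) (x N)"
  shows "\<forall>k\<in>{1..<N}. cis (2 * pi * (x N - x k)) \<noteq> 1"
    and "(\<Sum>k\<in>{1..<N}. - ln (cmod (1 - cis (2 * pi * (x N - x k))))) \<le> 0"
proof -
  define f where "f = (\<lambda>k. 2 * sin (pi * \<bar>x N - x k\<bar>))"
  have "x k \<in> {0..1}" if "k \<in> {1..<N}" for k using x[of k] that by simp
  then obtain y where "admissible x N y" "energy x N y \<le> ereal (real N - 1)"
    using exists_admissible_nonpositive_potential[OF N, of x] by blast
  then have le: "energy x N (x N) \<le> ereal (real N - 1)"
    using min by (auto simp: is_arg_min_def not_less intro: order_trans)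
  have pos: "f k > 0" if k: "k \<in> {1..<N}" for k
  proof (rule ccontr)
    assume "\<not> f k > 0"
    then have "1 - ext_ln (f k) = \<infinity>" by (simp add: ext_ln_def)
    then have "energy x N (x N) = \<infinity>"
      unfolding energy_def f_def using k by (subst sum_Pinfty) auto
    then show False using le by simp
  qed
  have f: "cmod (1 - cis (2 * pi * (x N - x k))) = f k" if "k \<in> {1..<N}" for k
  proof -
    have "\<bar>sin (pi * (x N - x k))\<bar> = \<bar>sin (pi * \<bar>x N - x k\<bar>)\<bar>" by (rule abs_sin_mult_abs[symmetric])
    then show ?thesis using pos[OF that] by (simp add: cmod_one_minus_cis f_def)
  qed
  show "\<forall>k\<in>{1..<N}. cis (2 * pi * (x N - x k)) \<noteq> 1" using f pos by force
  have "energy x N (x N) = (\<Sum>k\<in>{1..<N}. ereal (1 - ln (f k)))"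
    unfolding energy_def using pos by (intro sum.cong) (auto simp: f_def ext_ln_def one_ereal_def)
  also have "\<dots> = ereal (real N - 1 + (\<Sum>k\<in>{1..<N}. - ln (f k)))"
    using N by (simp add: sum_subtractf of_nat_diff sum_negf)
  finally show "(\<Sum>k\<in>{1..<N}. - ln (cmod (1 - cis (2 * pi * (x N - x k))))) \<le> 0"
    using le f by simp
qed

section \<open>Partial sums of a quadratic Fourier series\<close>

text \<open>The Dirichlet kernel, multiplied out so that the identity also holds at the zeros of
  \<open>sin (t/2)\<close>.\<close>

lemma sum_cos_half:
  "sin (t/2) * (1 + 2 * (\<Sum>k=1..K. cos (real k * t))) = sin ((2 * real K + 1) * t / 2)"
proof (induction K)
  case (Suc K)
  have "sin ((2 * real (Suc K) + 1) * t / 2) = sin ((2 * real K + 1) * t / 2) + 2 * sin (t/2) * cos (real (Suc K) * t)"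
  proof -
    have "sin (real (Suc K) * t + t/2) - sin (real (Suc K) * t - t/2) = 2 * sin (t/2) * cos (real (Suc K) * t)"
      by (simp add: sin_add sin_diff)
    moreover have "real (Suc K) * t + t/2 = (2 * real (Suc K) + 1) * t / 2" "real (Suc K) * t - t/2 = (2 * real K + 1) * t / 2"
      by (simp_all add: field_simps)
    ultimately show ?thesis by (simp only:)
  qed
  then show ?case using Suc by (simp add: algebra_simps)
qed simp

text \<open>
  The derivative of the left-hand side is a Dirichlet kernel. Integrating it by parts leaves \<open>v\<close>, whose
  derivative is dominated by that of the monotone function \<open>w\<close>.
\<close>

lemma sawtooth_partial_sum_bound:
  assumes "0 < t" "t \<le> pi"
  shows "\<bar>(t - pi)/2 + (\<Sum>k=1..K. sin (real k * t) / real k)\<bar> \<le> 2 / ((2 * real K + 1) * sin (t/2))"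
proof -
  define n where "n = 2 * real K + 1"
  have n: "n \<ge> 1" by (simp add: n_def)
  define s where "s = (\<lambda>t::real. (t - pi)/2 + (\<Sum>k=1..K. sin (real k * t) / real k))"
  \<comment> \<open>Integrating \<open>sin (n * u / 2) / (2 * sin (u/2))\<close> by parts produces
    the boundary term \<open>- cos (n * u / 2) * w u\<close>; \<open>v\<close> is what remains of
    \<open>s\<close> after removing it.\<close>
  define w where "w = (\<lambda>t::real. 1 / (n * sin (t/2)))"
  define v where "v = (\<lambda>t::real. s t + cos (n * t / 2) * w t)"
  define w' where "w' = (\<lambda>t::real. - cos (t/2) / (2 * n * (sin (t/2))\<^sup>2))"
  have pos: "sin (u/2) > 0" if "u \<in> {0<..pi}" for u
    using that by (intro sin_gt_zero) auto
  have dw: "(w has_real_derivative w' u) (at u)" if "u \<in> {0<..pi}" for u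
    unfolding w_def w'_def using pos[OF that] n
    by (auto intro!: derivative_eq_intros simp: field_simps power2_eq_square)
  have ds: "(s has_real_derivative sin (n * u / 2) / (2 * sin (u/2))) (at u)" if "u \<in> {0<..pi}" for u
  proof -
    have "(s has_real_derivative (1/2 + (\<Sum>k=1..K. cos (real k * u)))) (at u)"
      unfolding s_def by (auto intro!: derivative_eq_intros sum.cong)
    moreover have "1/2 + (\<Sum>k=1..K. cos (real k * u)) = sin (n * u / 2) / (2 * sin (u/2))"
      using sum_cos_half[of u K] pos[OF that] unfolding n_def
      by (simp add: divide_simps) (simp add: algebra_simps)
    ultimately show ?thesis by simp
  qed
  have dv: "(v has_real_derivative cos (n * u / 2) * w' u) (at u)" if "u \<in> {0<..pi}" for u
  proof -
    have "((\<lambda>u. cos (n * u / 2)) has_real_derivative - sin (n * u / 2) * (n/2)) (at u)"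
      by (auto intro!: derivative_eq_intros)
    from DERIV_add[OF ds[OF that] DERIV_mult[OF this dw[OF that]]]
    have "(v has_real_derivative sin (n * u / 2) / (2 * sin (u/2)) +
         (- sin (n * u / 2) * (n/2) * w u + w' u * cos (n * u / 2))) (at u)"
      unfolding v_def .
    moreover have "n/2 * w u = 1 / (2 * sin (u/2))" using n by (simp add: w_def)
    ultimately show ?thesis using n by (simp add: algebra_simps w_def)
  qed
  have w'le: "w' u \<le> 0" if "u \<in> {0<..pi}" for u
  proof -
    have "cos (u/2) \<ge> 0" using that by (intro cos_ge_zero) auto
    then show ?thesis unfolding w'_def using n by (simp add: divide_nonneg_nonneg)
  qed
  have c1: "\<bar>cos (n * u / 2) * w' u\<bar> \<le> - w' u" if "u \<in> {0<..pi}" for u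
    using w'le[OF that] mult_right_mono[OF abs_cos_le_one, of "\<bar>w' u\<bar>" "n*u/2"] by (simp add: abs_mult)
  \<comment> \<open>Every \<open>sin (k * pi)\<close> vanishes, and \<open>n\<close> is odd, so
    \<open>n * pi / 2\<close> is a zero of the cosine.\<close>
  have vpi: "v pi = 0"
  proof -
    have "s pi = 0" by (simp add: s_def)
    moreover have "cos (n * pi / 2) = 0"
    proof -
      have "n * pi / 2 = real K * pi + pi/2" by (simp add: n_def field_simps)
      then show ?thesis by (simp only: cos_add) simp
    qed
    ultimately show ?thesis by (simp add: v_def)
  qed
  have wpi: "w pi \<ge> 0" using n by (simp add: w_def)
  \<comment> \<open>By \<open>c1\<close>, \<open>v + w\<close> is nonincreasing and
    \<open>v - w\<close> is nondecreasing; comparison with the endpoint \<open>pi\<close> bounds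
    \<open>v t\<close> on both sides.\<close>
  have "v pi + w pi \<le> v t + w t"
  proof (rule DERIV_nonpos_imp_nonincreasing[OF assms(2)])
    fix u assume "t \<le> u" "u \<le> pi"
    then have u: "u \<in> {0<..pi}" using assms by auto
    show "\<exists>y. ((\<lambda>u. v u + w u) has_real_derivative y) (at u) \<and> y \<le> 0"
      using DERIV_add[OF dv[OF u] dw[OF u]] c1[OF u] by (intro exI conjI) (assumption, linarith)
  qed
  moreover have "v t - w t \<le> v pi - w pi"
  proof (rule DERIV_nonneg_imp_nondecreasing[OF assms(2)])
    fix u assume "t \<le> u" "u \<le> pi"
    then have u: "u \<in> {0<..pi}" using assms by auto
    show "\<exists>y. ((\<lambda>u. v u - w u) has_real_derivative y) (at u) \<and> y \<ge> 0"
      using DERIV_diff[OF dv[OF u] dw[OF u]] c1[OF u] by (intro exI conjI) (assumption, linarith)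
  qed
  ultimately have v: "\<bar>v t\<bar> \<le> w t" using vpi wpi by linarith
  have wt: "w t \<ge> 0" using n pos[of t] assms by (simp add: w_def)
  have "\<bar>cos (n * t / 2) * w t\<bar> \<le> w t"
    using wt mult_right_mono[OF abs_cos_le_one, of "w t" "n*t/2"] by (simp add: abs_mult)
  then have "\<bar>s t\<bar> \<le> 2 * w t" using v unfolding v_def by linarith
  then show ?thesis by (simp add: s_def w_def n_def)
qed

text \<open>Telescoping, from \<open>1 / (k + 1)^2 \<le> 1 / k - 1 / (k + 1)\<close>.\<close>

lemma sum_inverse_squares_tail:
  assumes "1 \<le> K" "K \<le> M"
  shows "(\<Sum>k=Suc K..M. 1 / (real k)\<^sup>2) \<le> 1 / real K"
proof -
  have "(\<Sum>k=Suc K..M. 1 / (real k)\<^sup>2) \<le> 1 / real K - 1 / real M"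
    using assms(2)
  proof (induction M rule: dec_induct)
    case (step M)
    have "real M > 0" using step assms by simp
    then have "1 / (real (Suc M))\<^sup>2 \<le> 1 / real M - 1 / real (Suc M)"
      by (simp add: divide_simps power2_eq_square)
    then show ?case using step by (simp add: sum.nat_ivl_Suc')
  qed simp
  then show ?thesis by (smt (verit) divide_nonneg_nonneg of_nat_0_le_iff)
qed

text \<open>Partial sum of the Fourier series of \<open>(t - pi)^2 / 4 - pi^2 / 12\<close> on
  \<open>[0, 2 * pi]\<close>.\<close>

definition cos_sum :: "nat \<Rightarrow> real \<Rightarrow> real" where
  "cos_sum K t = (\<Sum>k=1..K. cos (real k * t) / (real k)\<^sup>2)"

lemma cos_sum_diff:
  assumes "1 \<le> K" "K \<le> M"
  shows "\<bar>cos_sum M t - cos_sum K t\<bar> \<le> 1 / real K"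
proof -
  have "{1..M} = {1..K} \<union> {Suc K..M}" using assms by auto
  then have "cos_sum M t = cos_sum K t + (\<Sum>k=Suc K..M. cos (real k * t) / (real k)\<^sup>2)"
    unfolding cos_sum_def by (simp add: sum.union_disjoint)
  moreover have "\<bar>\<Sum>k=Suc K..M. cos (real k * t) / (real k)\<^sup>2\<bar> \<le> (\<Sum>k=Suc K..M. 1 / (real k)\<^sup>2)"
    by (rule order_trans[OF sum_abs]) (intro sum_mono, simp add: divide_right_mono)
  ultimately show ?thesis using sum_inverse_squares_tail[OF assms] by simp
qed

text \<open>Subtracting the value at \<open>pi\<close> fixes the additive constant. The derivative
  of the remainder \<open>h M\<close> is the sawtooth remainder, so the mean value theorem makes
  \<open>h M t - h M pi\<close> tend to 0 as \<open>M\<close> grows. Going back from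
  \<open>M\<close> to \<open>K\<close> costs \<open>1 / K\<close> at each of \<open>t\<close> and
  \<open>pi\<close>.\<close>

lemma cos_sum_quadratic_half:
  assumes K: "1 \<le> K" and t: "0 < t" "t < pi"
  shows "\<bar>(t - pi)\<^sup>2/4 - cos_sum K t + cos_sum K pi\<bar> \<le> 2 / real K"
proof -
  define h where "h = (\<lambda>M t. (t - pi)\<^sup>2/4 - cos_sum M t)"
  have bound: "\<bar>h M t - h M pi\<bar> \<le> pi * (2 / ((2 * real M + 1) * sin (t/2)))" for M
  proof -
    have d: "(h M has_real_derivative ((u - pi)/2 + (\<Sum>k=1..M. sin (real k * u) / real k))) (at u)" for u
      unfolding h_def cos_sum_def
      by (rule derivative_eq_intros refl | simp)+
         (auto simp: sum_negf[symmetric] divide_simps power2_eq_square power4_eq_xxxx intro!: sum.cong)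
    obtain u where u: "t < u" "u < pi"
      "h M pi - h M t = (pi - t) * ((u - pi)/2 + (\<Sum>k=1..M. sin (real k * u) / real k))"
      using MVT2[OF t(2) d] by blast
    \<comment> \<open>Sine increases on \<open>[0, pi/2]\<close>, so the bound at the unknown point
      \<open>u\<close> is no worse than at \<open>t\<close>.\<close>
    have "sin (t/2) > 0" "sin (t/2) \<le> sin (u/2)"
      using t u by (auto intro!: sin_gt_zero sin_monotone_2pi_le)
    then have "2 / ((2 * real M + 1) * sin (u/2)) \<le> 2 / ((2 * real M + 1) * sin (t/2))"
      by (intro divide_left_mono mult_left_mono mult_pos_pos) auto
    then have "\<bar>(u - pi)/2 + (\<Sum>k=1..M. sin (real k * u) / real k)\<bar> \<le> 2 / ((2 * real M + 1) * sin (t/2))"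
      using sawtooth_partial_sum_bound[of u M] t u by linarith
    then have "\<bar>h M pi - h M t\<bar> \<le> pi * (2 / ((2 * real M + 1) * sin (t/2)))"
      unfolding u(3) abs_mult using t by (intro mult_mono) auto
    then show ?thesis by (simp add: abs_minus_commute)
  qed
  have "(\<lambda>M. pi * (2 / ((2 * real M + 1) * sin (t/2)))) \<longlonglongrightarrow> 0"
  proof -
    have "(\<lambda>M. inverse (real (Suc (2 * M)))) \<longlonglongrightarrow> 0"
      using LIMSEQ_subseq_LIMSEQ[OF LIMSEQ_inverse_real_of_nat, of "\<lambda>M. 2 * M"]
      by (simp add: strict_mono_def o_def)
    then have "(\<lambda>M. (2 * pi / sin (t/2)) * inverse (real (Suc (2 * M)))) \<longlonglongrightarrow> (2 * pi / sin (t/2)) * 0"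
      by (intro tendsto_mult tendsto_const)
    then show ?thesis by (simp add: field_simps)
  qed
  then have "(\<lambda>M. 2 / real K + pi * (2 / ((2 * real M + 1) * sin (t/2)))) \<longlonglongrightarrow> 2 / real K + 0"
    by (intro tendsto_intros)
  moreover have "\<forall>M\<ge>K. \<bar>h K t - h K pi\<bar> \<le> 2 / real K + pi * (2 / ((2 * real M + 1) * sin (t/2)))"
  proof (intro allI impI)
    fix M assume "K \<le> M"
    show "\<bar>h K t - h K pi\<bar> \<le> 2 / real K + pi * (2 / ((2 * real M + 1) * sin (t/2)))"
      using cos_sum_diff[OF K \<open>K \<le> M\<close>, of t] cos_sum_diff[OF K \<open>K \<le> M\<close>, of pi] bound[of M]
      unfolding h_def by linarith
  qed
  ultimately have "\<bar>h K t - h K pi\<bar> \<le> 2 / real K + 0"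
    by (intro LIMSEQ_le_const) auto
  then show ?thesis by (simp add: h_def)
qed

text \<open>Continuity adds the endpoints 0 and \<open>pi\<close>; the reflection \<open>t\<close>
  to \<open>2 * pi - t\<close>, which preserves both the parabola and the cosines, gives the other
  half.\<close>

lemma cos_sum_quadratic:
  assumes K: "1 \<le> K" and t: "0 \<le> t" "t \<le> 2 * pi"
  shows "\<bar>(t - pi)\<^sup>2/4 - cos_sum K t + cos_sum K pi\<bar> \<le> 2 / real K"
proof -
  define F where "F = (\<lambda>t. \<bar>(t - pi)\<^sup>2/4 - cos_sum K t + cos_sum K pi\<bar>)"
  have *: "F t \<le> 2 / real K" if "t \<in> {0..pi}" for t
  proof (rule continuous_le_on_closure[where S = "{0<..<pi}" and f = F])
    show "continuous_on (closure {0<..<pi}) F"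
      unfolding F_def cos_sum_def by (intro continuous_intros) auto
    show "t \<in> closure {0<..<pi}" using that by (simp add: closure_greaterThanLessThan)
    show "F x \<le> 2 / real K" if "x \<in> {0<..<pi}" for x
      using cos_sum_quadratic_half[OF K] that by (simp add: F_def)
  qed
  show ?thesis
  proof (cases "t \<le> pi")
    case True
    then show ?thesis using *[of t] t by (simp add: F_def)
  next
    case False
    have "cos (real k * (2 * pi - t)) = cos (real k * t)" for k
    proof -
      have "real k * (2 * pi - t) = 2 * pi * real k - real k * t" by (simp add: algebra_simps)
      moreover have "cos (2 * pi * real k) = 1" "sin (2 * pi * real k) = 0"
        using cos_2npi[of k] sin_2npi[of k] by (simp_all add: mult_ac)
      ultimately show ?thesis by (simp add: cos_diff)
    qed
    then have "cos_sum K (2 * pi - t) = cos_sum K t" by (simp add: cos_sum_def)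
    moreover have "(2 * pi - t - pi)\<^sup>2 = (t - pi)\<^sup>2" by (simp add: power2_eq_square algebra_simps)
    ultimately show ?thesis using *[of "2 * pi - t"] t False by (simp add: F_def)
  qed
qed

section \<open>Counting points in an interval\<close>

text \<open>Trigonometric approximation of the 1-periodic extension of \<open>y\<^sup>2 - y\<close> from \<open>[0, 1]\<close>.\<close>

definition trig_quadratic :: "nat \<Rightarrow> real \<Rightarrow> real" where
  "trig_quadratic K y = (cos_sum K (2 * pi * y) - cos_sum K pi) / pi\<^sup>2 - 1/4"

lemma trig_quadratic_minus: "trig_quadratic K (- y) = trig_quadratic K y"
  by (simp add: trig_quadratic_def cos_sum_def)

lemma trig_quadratic_abs: "trig_quadratic K \<bar>y\<bar> = trig_quadratic K y"
  by (simp add: abs_if trig_quadratic_minus)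

lemma trig_quadratic_minus_one: "trig_quadratic K (y - 1) = trig_quadratic K y"
proof -
  have "cos (real k * (2 * pi * (y - 1))) = cos (real k * (2 * pi * y))" for k
  proof -
    have "real k * (2 * pi * (y - 1)) = real k * (2 * pi * y) - 2 * pi * real k" by (simp add: algebra_simps)
    moreover have "cos (2 * pi * real k) = 1" "sin (2 * pi * real k) = 0"
      using cos_2npi[of k] sin_2npi[of k] by (simp_all add: mult_ac)
    ultimately show ?thesis by (simp add: cos_diff)
  qed
  then show ?thesis by (simp add: trig_quadratic_def cos_sum_def)
qed

lemma trig_quadratic_approx:
  assumes K: "1 \<le> K" and y: "\<bar>y\<bar> \<le> 1"
  shows "\<bar>trig_quadratic K y - (y\<^sup>2 - \<bar>y\<bar>)\<bar> \<le> 1 / real K"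
proof -
  define z where "z = \<bar>y\<bar>"
  have z: "0 \<le> z" "z \<le> 1" using y by (auto simp: z_def)
  have "(2 * pi * z - pi)\<^sup>2 / 4 - cos_sum K (2 * pi * z) + cos_sum K pi
      = pi\<^sup>2 * ((z\<^sup>2 - z) - trig_quadratic K z)"
    by (simp add: trig_quadratic_def power2_eq_square field_simps)
  then have "pi\<^sup>2 * \<bar>(z\<^sup>2 - z) - trig_quadratic K z\<bar> \<le> 2 / real K"
    using cos_sum_quadratic[OF K, of "2 * pi * z"] z by (simp add: abs_mult)
  \<comment> \<open>Absorbs the 2 in \<open>2 / K\<close> when dividing by
    \<open>pi^2\<close>.\<close>
  moreover have "2 \<le> pi\<^sup>2"
    using pi_ge_two power_mono[of 2 pi 2] by simp
  then have "2 * \<bar>(z\<^sup>2 - z) - trig_quadratic K z\<bar> \<le> pi\<^sup>2 * \<bar>(z\<^sup>2 - z) - trig_quadratic K z\<bar>"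
    by (intro mult_right_mono) auto
  ultimately have "\<bar>(z\<^sup>2 - z) - trig_quadratic K z\<bar> \<le> 1 / real K" by simp
  then show ?thesis by (simp add: z_def trig_quadratic_abs abs_minus_commute)
qed

text \<open>The shifted arguments in the trapezoid can leave \<open>[-1, 1]\<close>. There the
  periodic extension lies below the unshifted parabola, so the upper estimate persists.\<close>

lemma trig_quadratic_upper:
  assumes K: "1 \<le> K" and y: "\<bar>y\<bar> \<le> 2"
  shows "trig_quadratic K y \<le> y\<^sup>2 - \<bar>y\<bar> + 1 / real K"
proof (cases "\<bar>y\<bar> \<le> 1")
  case True
  then show ?thesis using trig_quadratic_approx[OF K, of y] by linarith
next
  case False
  define z where "z = \<bar>y\<bar> - 1"
  have z: "0 \<le> z" "z \<le> 1" using y False by (auto simp: z_def)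
  have "trig_quadratic K y = trig_quadratic K z"
    by (simp add: z_def trig_quadratic_minus_one trig_quadratic_abs)
  also have "\<dots> \<le> z\<^sup>2 - z + 1 / real K" using trig_quadratic_approx[OF K, of z] z by simp
  also have "z\<^sup>2 - z \<le> (z + 1)\<^sup>2 - (z + 1)" using z by (simp add: power2_eq_square algebra_simps)
  also have "\<dots> = y\<^sup>2 - \<bar>y\<bar>" by (simp add: z_def)
  finally show ?thesis by simp
qed

text \<open>
  The right-hand side is, up to the last term, the trapezoid of height 1 on \<open>[a, b]\<close> with ramps of
  length \<open>d\<close>: its second derivative consists of point masses at \<open>a - d, a, b, b + d\<close>, while that of
  \<open>y\<^sup>2 - \<bar>y\<bar>\<close> is \<open>2\<close> minus twice the point mass at \<open>0\<close>.
\<close>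

lemma trapezoid_majorant:
  assumes K: "1 \<le> K" and ab: "0 \<le> a" "a \<le> b" "b \<le> 1" and d: "0 < d" "d \<le> 1" and x: "x \<in> {0..1}"
  shows "of_bool (x \<in> {a..b}) \<le> (b - a) + d + (trig_quadratic K (x - a) - trig_quadratic K (x - a + d)
           + (trig_quadratic K (x - b) - trig_quadratic K (x - b - d))) / (2 * d) + 2 / (d * real K)"
proof -
  define Q where "Q = trig_quadratic K (x - a) - trig_quadratic K (x - a + d)
           + (trig_quadratic K (x - b) - trig_quadratic K (x - b - d))"
  \<comment> \<open>The positive terms have arguments in \<open>[-1, 1]\<close>, where a lower
    estimate is available; the shifted terms carry a minus sign, so their upper estimate
    suffices.\<close>
  have "Q \<ge> ((x - a)\<^sup>2 - \<bar>x - a\<bar>) - ((x - a + d)\<^sup>2 - \<bar>x - a + d\<bar>)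
      + (((x - b)\<^sup>2 - \<bar>x - b\<bar>) - ((x - b - d)\<^sup>2 - \<bar>x - b - d\<bar>)) - 4 * (1 / real K)"
    using trig_quadratic_approx[OF K, of "x - a"] trig_quadratic_approx[OF K, of "x - b"]
      trig_quadratic_upper[OF K, of "x - a + d"] trig_quadratic_upper[OF K, of "x - b - d"] ab d x
    unfolding Q_def by (simp add: abs_le_iff)
  also have "((x - a)\<^sup>2 - \<bar>x - a\<bar>) - ((x - a + d)\<^sup>2 - \<bar>x - a + d\<bar>)
      + (((x - b)\<^sup>2 - \<bar>x - b\<bar>) - ((x - b - d)\<^sup>2 - \<bar>x - b - d\<bar>))
      = \<bar>x - a + d\<bar> - \<bar>x - a\<bar> + (\<bar>x - b - d\<bar> - \<bar>x - b\<bar>) - 2 * d * ((b - a) + d)"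
    by (simp add: power2_eq_square algebra_simps)
  finally have Q: "Q \<ge> \<bar>x - a + d\<bar> - \<bar>x - a\<bar> + (\<bar>x - b - d\<bar> - \<bar>x - b\<bar>) - 2 * d * ((b - a) + d) - 4 / real K"
    by simp
  \<comment> \<open>The right-hand side is \<open>2 * d\<close> times the trapezoid:
    \<open>2 * d\<close> on \<open>[a, b]\<close> and nonnegative elsewhere.\<close>
  moreover have "2 * d * of_bool (x \<in> {a..b}) \<le> \<bar>x - a + d\<bar> - \<bar>x - a\<bar> + (\<bar>x - b - d\<bar> - \<bar>x - b\<bar>)"
    using ab d by (auto simp: abs_if)
  ultimately have "2 * d * of_bool (x \<in> {a..b}) \<le> Q + 2 * d * ((b - a) + d) + 4 / real K"
    by linarith
  then have "of_bool (x \<in> {a..b}) \<le> (Q + 2 * d * ((b - a) + d) + 4 / real K) / (2 * d)"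
    using d by (simp add: pos_le_divide_eq mult_ac)
  also have "\<dots> = (b - a) + d + Q / (2 * d) + 2 / (d * real K)"
    using d by (simp add: add_divide_distrib)
  finally show ?thesis by (simp add: Q_def)
qed

text \<open>The difference \<open>cis u - cis v\<close> factors out of the exponential sum, and a
  chord is no longer than its arc.\<close>

lemma sum_cos_diff_le:
  "\<bar>\<Sum>i\<in>I. cos (y i + u) - cos (y i + v)\<bar> \<le> cmod (\<Sum>i\<in>I. cis (y i)) * \<bar>u - v\<bar>"
proof -
  have "(\<Sum>i\<in>I. cos (y i + u) - cos (y i + v)) = Re ((\<Sum>i\<in>I. cis (y i)) * (cis u - cis v))"
    by (simp add: sum_distrib_right right_diff_distrib cis_mult sum_subtractf del: times_complex.sel)
  also have "\<bar>\<dots>\<bar> \<le> cmod (\<Sum>i\<in>I. cis (y i)) * cmod (cis u - cis v)"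
    by (metis abs_Re_le_cmod norm_mult)
  also have "cmod (cis u - cis v) \<le> \<bar>u - v\<bar>"
  proof -
    have "cis u - cis v = cis u * (1 - cis (v - u))" by (simp add: right_diff_distrib cis_mult)
    then have "cmod (cis u - cis v) = cmod (1 - cis (v - u))" by (simp add: norm_mult)
    also have "\<dots> = 2 * \<bar>sin ((v - u) / 2)\<bar>" by (rule cmod_one_minus_cis)
    also have "\<dots> \<le> \<bar>u - v\<bar>" using abs_sin_x_le_abs_x[of "(v - u) / 2"] by simp
    finally show ?thesis .
  qed
  finally show ?thesis by (simp add: mult_left_mono)
qed

text \<open>At frequency \<open>k\<close> the shift gains a factor
  \<open>k * \<bar>u - v\<bar>\<close>, which turns the weight \<open>1 / k^2\<close> into
  \<open>1 / k\<close>.\<close>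

lemma sum_trig_quadratic_diff_le:
  "\<bar>\<Sum>i\<in>I. trig_quadratic K (x i + u) - trig_quadratic K (x i + v)\<bar>
    \<le> 2 / pi * \<bar>u - v\<bar> * (\<Sum>k=1..K. cmod (\<Sum>i\<in>I. cis (real k * (2 * pi * x i))) / real k)"
proof -
  define E where "E = (\<lambda>k. cmod (\<Sum>i\<in>I. cis (real k * (2 * pi * x i))))"
  define F where "F = (\<lambda>k. \<Sum>i\<in>I. cos (real k * (2 * pi * x i) + real k * (2 * pi * u))
          - cos (real k * (2 * pi * x i) + real k * (2 * pi * v)))"
  have F: "\<bar>F k / (real k)\<^sup>2\<bar> \<le> 2 * pi * \<bar>u - v\<bar> * (E k / real k)" if "k \<in> {1..K}" for k
  proof -
    have k: "real k > 0" using that by simp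
    have "real k * (2 * pi * u) - real k * (2 * pi * v) = (real k * (2 * pi)) * (u - v)"
      by (simp add: algebra_simps)
    then have "\<bar>F k\<bar> \<le> E k * (real k * (2 * pi) * \<bar>u - v\<bar>)"
      using sum_cos_diff_le[of "\<lambda>i. real k * (2 * pi * x i)" "real k * (2 * pi * u)" "real k * (2 * pi * v)" I]
      by (simp add: E_def F_def abs_mult)
    then have "\<bar>F k\<bar> / (real k)\<^sup>2 \<le> E k * (real k * (2 * pi) * \<bar>u - v\<bar>) / (real k)\<^sup>2"
      by (intro divide_right_mono) auto
    then show ?thesis using k by (simp add: power2_eq_square mult_ac)
  qed
  have eq: "(\<Sum>i\<in>I. trig_quadratic K (x i + u) - trig_quadratic K (x i + v)) = (\<Sum>k=1..K. F k / (real k)\<^sup>2) / pi\<^sup>2"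
  proof -
    have "(\<Sum>i\<in>I. trig_quadratic K (x i + u) - trig_quadratic K (x i + v))
      = (\<Sum>i\<in>I. \<Sum>k=1..K. (cos (real k * (2 * pi * x i) + real k * (2 * pi * u))
          - cos (real k * (2 * pi * x i) + real k * (2 * pi * v))) / (real k)\<^sup>2) / pi\<^sup>2"
      by (simp add: trig_quadratic_def cos_sum_def diff_divide_distrib sum_divide_distrib sum_subtractf distrib_left)
    then show ?thesis
      by (subst (asm) sum.swap) (simp add: F_def sum_divide_distrib)
  qed
  have "\<bar>\<Sum>k=1..K. F k / (real k)\<^sup>2\<bar> \<le> (\<Sum>k=1..K. 2 * pi * \<bar>u - v\<bar> * (E k / real k))"
    using F by (intro order_trans[OF sum_abs] sum_mono)
  also have "\<dots> = 2 * pi * \<bar>u - v\<bar> * (\<Sum>k=1..K. E k / real k)"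
    by (simp only: sum_distrib_left)
  finally have "\<bar>\<Sum>k=1..K. F k / (real k)\<^sup>2\<bar> / pi\<^sup>2
      \<le> 2 * pi * \<bar>u - v\<bar> * (\<Sum>k=1..K. E k / real k) / pi\<^sup>2"
    by (intro divide_right_mono) auto
  also have "\<dots> = 2 / pi * \<bar>u - v\<bar> * (\<Sum>k=1..K. E k / real k)"
    by (simp add: power2_eq_square)
  finally show ?thesis by (simp add: eq E_def)
qed

text \<open>Sums the trapezoid majorant over the points. Both differences have step
  \<open>d\<close>, which cancels the \<open>d\<close> in the denominator
  \<open>2 * d\<close>.\<close>

lemma card_interval_le:
  assumes K: "1 \<le> K" and ab: "0 \<le> a" "a \<le> b" "b \<le> 1" and d: "0 < d" "d \<le> 1"
    and I: "finite I" and x: "\<And>i. i \<in> I \<Longrightarrow> x i \<in> {0..1}"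
  shows "real (card {i \<in> I. x i \<in> {a..b}}) \<le> real (card I) * (b - a) + real (card I) * d
      + (\<Sum>k=1..K. cmod (\<Sum>i\<in>I. cis (real k * (2 * pi * x i))) / real k) + 2 * real (card I) / (d * real K)"
proof -
  define S where "S = (\<Sum>k=1..K. cmod (\<Sum>i\<in>I. cis (real k * (2 * pi * x i))) / real k)"
  define Q where "Q = (\<Sum>i\<in>I. trig_quadratic K (x i - a) - trig_quadratic K (x i - a + d)
           + (trig_quadratic K (x i - b) - trig_quadratic K (x i - b - d)))"
  have S: "S \<ge> 0" unfolding S_def by (intro sum_nonneg) simp
  have "\<bar>\<Sum>i\<in>I. trig_quadratic K (x i + - a) - trig_quadratic K (x i + (- a + d))\<bar> \<le> 2 / pi * d * S"
    "\<bar>\<Sum>i\<in>I. trig_quadratic K (x i + - b) - trig_quadratic K (x i + (- b - d))\<bar> \<le> 2 / pi * d * S"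
    using sum_trig_quadratic_diff_le[of K x "- a" "- a + d" I]
      sum_trig_quadratic_diff_le[of K x "- b" "- b - d" I] d by (simp_all add: S_def)
  moreover have "Q = (\<Sum>i\<in>I. trig_quadratic K (x i + - a) - trig_quadratic K (x i + (- a + d)))
      + (\<Sum>i\<in>I. trig_quadratic K (x i + - b) - trig_quadratic K (x i + (- b - d)))"
    unfolding Q_def sum.distrib[symmetric] by (simp add: algebra_simps)
  ultimately have "Q \<le> 2 / pi * d * S + 2 / pi * d * S" by (smt (verit))
  also have "\<dots> = 4 / pi * d * S" by simp
  also have "\<dots> \<le> 2 * d * S"
    using S d pi_ge_two by (intro mult_right_mono) (auto simp: field_simps)
  finally have Q: "Q / (2 * d) \<le> S" using d by (simp add: field_simps)
  have "real (card {i \<in> I. x i \<in> {a..b}}) = (\<Sum>i\<in>I. of_bool (x i \<in> {a..b}))"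
    using I by (simp add: of_bool_def sum.If_cases Int_def)
  also have "\<dots> \<le> (\<Sum>i\<in>I. (b - a) + d + (trig_quadratic K (x i - a) - trig_quadratic K (x i - a + d)
           + (trig_quadratic K (x i - b) - trig_quadratic K (x i - b - d))) / (2 * d) + 2 / (d * real K))"
    by (intro sum_mono trapezoid_majorant K ab d x)
  also have "\<dots> = real (card I) * (b - a) + real (card I) * d + Q / (2 * d) + 2 * real (card I) / (d * real K)"
    by (simp only: sum.distrib sum_constant sum_divide_distrib[symmetric] Q_def) simp
  finally show ?thesis using Q unfolding S_def by linarith
qed

section \<open>Discrepancy of greedy sequences\<close>

lemma greedy_exponential_sums:
  fixes m N :: nat
  assumes m: "1 \<le> m" and x: "\<And>k. 1 \<le> k \<Longrightarrow> x k \<in> {0..1}" and greedy: "greedy_from m x" and N: "2 \<le> N"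
  shows "(\<Sum>k=1..N. (cmod (\<Sum>i=1..N. cis (real k * (2 * pi * x i))))\<^sup>2 / real k)
      \<le> 2 * (real N * (ln (2 * real N) + 1) + 2 * (real m)\<^sup>2 * ln (2 * real N))"
proof -
  define L where "L = ln (2 * real N)"
  \<comment> \<open>Far enough from 1 for the kernel to stay below \<open>ln (2 * N)\<close>, close
    enough for \<open>r ^ k\<close> to be at least \<open>1/2\<close> up to
    \<open>k = N\<close>.\<close>
  define r where "r = 1 - 1 / (2 * real N)"
  define y where "y = (\<lambda>i. 2 * pi * x i)"
  define f where "f = (\<lambda>i j. - ln (cmod (1 - of_real r * cis (y i - y j))))"
  have L: "L \<ge> 0" using N by (simp add: L_def)
  have r: "0 < r" "r < 1" using N by (auto simp: r_def field_simps)
  have sym: "f i j = f j i" for i j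
  proof -
    have "cnj (1 - of_real r * cis (y i - y j)) = 1 - of_real r * cis (y j - y i)"
      by (simp add: cis_cnj)
    then show ?thesis unfolding f_def by (metis complex_mod_cnj)
  qed
  have fL: "f i j \<le> L" for i j
  proof -
    have "ln (1 - r) \<le> ln (cmod (1 - of_real r * cis (y i - y j)))"
      using cmod_one_minus_scaled_cis_ge(2)[of r "y i - y j"] r by (intro ln_mono) auto
    moreover have "ln (1 - r) = - L" using N by (simp add: r_def L_def ln_div)
    ultimately show ?thesis by (simp add: f_def)
  qed
  have lnr: "- ln (sqrt r) \<le> 1 / (2 * real N)"
  proof -
    have "- ln r = ln (1 / r)" using r by (simp add: ln_div)
    also have "\<dots> \<le> 1 / r - 1" using r by (intro ln_le_minus_one) auto
    also have "\<dots> \<le> 1 / real N" using N by (simp add: r_def field_simps)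
    finally show ?thesis using r by (simp add: ln_sqrt)
  qed
  \<comment> \<open>The true potential at a greedy point is at most 0, and regularising raises each
    of its fewer than \<open>N\<close> terms by at most \<open>1 / (2 * N)\<close>.\<close>
  have row: "(\<Sum>i\<in>{1..<j}. f i j) \<le> 1/2" if j: "m < j" "j \<le> N" for j
  proof -
    have "is_arg_min (energy x j) (admissible x j) (x j)" using greedy j by (simp add: greedy_from_def)
    note gr = greedy_potential_nonpos[OF _ _ this]
    have ne: "\<forall>k\<in>{1..<j}. cis (2 * pi * (x j - x k)) \<noteq> 1"
      and le: "(\<Sum>k\<in>{1..<j}. - ln (cmod (1 - cis (2 * pi * (x j - x k))))) \<le> 0"
      by (rule gr; use m j x in simp)+
    have "f i j \<le> - ln (cmod (1 - cis (2 * pi * (x j - x i)))) + 1 / (2 * real N)" if i: "i \<in> {1..<j}" for i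
    proof -
      define w where "w = cmod (1 - cis (2 * pi * (x j - x i)))"
      have w: "w > 0" using ne i by (simp add: w_def)
      have "ln (sqrt r * w) \<le> ln (cmod (1 - of_real r * cis (y j - y i)))"
      proof -
        have "y j - y i = 2 * pi * (x j - x i)" by (simp add: y_def algebra_simps)
        then have "sqrt r * w \<le> cmod (1 - of_real r * cis (y j - y i))"
          using cmod_one_minus_scaled_cis_ge(1)[of r "y j - y i"] r by (simp add: w_def)
        moreover have "0 < sqrt r * w" using r w by simp
        ultimately show ?thesis by (intro ln_mono) auto
      qed
      moreover have "ln (sqrt r * w) = ln (sqrt r) + ln w" using r w by (simp add: ln_mult)
      ultimately have "f j i \<le> - ln w + 1 / (2 * real N)" using lnr unfolding f_def by linarith
      then show ?thesis using sym[of i j] by (simp add: w_def)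
    qed
    then have "(\<Sum>i\<in>{1..<j}. f i j) \<le> (\<Sum>i\<in>{1..<j}. - ln (cmod (1 - cis (2 * pi * (x j - x i)))) + 1 / (2 * real N))"
      by (rule sum_mono)
    also have "\<dots> = (\<Sum>i\<in>{1..<j}. - ln (cmod (1 - cis (2 * pi * (x j - x i))))) + real (j - 1) * (1 / (2 * real N))"
      by (simp only: sum.distrib sum_constant card_atLeastLessThan)
    also have "\<dots> \<le> 0 + real N * (1 / (2 * real N))"
      using le j by (intro add_mono mult_right_mono) auto
    also have "\<dots> = 1/2" using N by simp
    finally show ?thesis .
  qed
  have "(\<Sum>i=1..N. \<Sum>j=1..N. f i j) = (\<Sum>j=1..N. f j j + 2 * (\<Sum>i\<in>{1..<j}. f i j))"
    by (rule sum_square_eq_sum_triangle) (rule sym)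
  \<comment> \<open>The diagonal gives \<open>L\<close> and a greedy row counted twice gives 1. For
    the arbitrary initial points, each of the fewer than \<open>m\<close> earlier terms is bounded
    by \<open>L\<close>.\<close>
  also have "\<dots> \<le> (\<Sum>j=1..N. (L + 1) + (if j \<in> {1..m} then 2 * real m * L else 0))"
  proof (rule sum_mono)
    fix j assume j: "j \<in> {1..N}"
    show "f j j + 2 * (\<Sum>i\<in>{1..<j}. f i j) \<le> (L + 1) + (if j \<in> {1..m} then 2 * real m * L else 0)"
    proof (cases "j \<in> {1..m}")
      case True
      have "(\<Sum>i\<in>{1..<j}. f i j) \<le> (\<Sum>i\<in>{1..<j}. L)" by (intro sum_mono fL)
      also have "\<dots> = real (j - 1) * L" by simp
      also have "\<dots> \<le> real m * L" using True L by (intro mult_right_mono) auto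
      finally show ?thesis using fL[of j j] unfolding if_P[OF True] by linarith
    next
      case False
      then have "(\<Sum>i\<in>{1..<j}. f i j) \<le> 1/2" using j by (intro row) auto
      then show ?thesis using fL[of j j] unfolding if_not_P[OF False] by linarith
    qed
  qed
  also have "\<dots> = real N * (L + 1) + (\<Sum>j\<in>{1..N} \<inter> {1..m}. 2 * real m * L)"
    by (subst sum.inter_restrict) (simp_all only: finite_atLeastAtMost sum.distrib sum_constant card_atLeastAtMost diff_Suc_1 distrib_left)
  also have "\<dots> \<le> real N * (L + 1) + real m * (2 * real m * L)"
  proof -
    have "card ({1..N} \<inter> {1..m}) \<le> m" using card_mono[of "{1..m}" "{1..N} \<inter> {1..m}"] by simp
    then have "real (card ({1..N} \<inter> {1..m})) * (2 * real m * L) \<le> real m * (2 * real m * L)"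
      using L by (intro mult_right_mono) auto
    then show ?thesis by (simp only: sum_constant add_le_cancel_left)
  qed
  finally have total: "(\<Sum>i=1..N. \<Sum>j=1..N. f i j) \<le> real N * (L + 1) + 2 * (real m)\<^sup>2 * L"
    by (simp add: power2_eq_square mult_ac)
  have half: "1 \<le> 2 * r ^ k" if "k \<le> N" for k
  proof -
    have "1 + real N * (- (1 / (2 * real N))) \<le> (1 + - (1 / (2 * real N))) ^ N"
      using N by (intro Bernoulli_inequality) simp
    then have "1/2 \<le> r ^ N" using N by (simp add: r_def)
    also have "\<dots> \<le> r ^ k" using r that by (intro power_decreasing) auto
    finally show ?thesis by simp
  qed
  have "(\<Sum>k=1..N. (cmod (\<Sum>i=1..N. cis (real k * y i)))\<^sup>2 / real k)
      \<le> (\<Sum>k=1..N. 2 * (r ^ k / real k * (cmod (\<Sum>i=1..N. cis (real k * y i)))\<^sup>2))"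
  proof (rule sum_mono)
    fix k assume k: "k \<in> {1..N}"
    have "1 * ((cmod (\<Sum>i=1..N. cis (real k * y i)))\<^sup>2 / real k) \<le> (2 * r ^ k) * ((cmod (\<Sum>i=1..N. cis (real k * y i)))\<^sup>2 / real k)"
      using half[of k] k by (intro mult_right_mono) auto
    then show "(cmod (\<Sum>i=1..N. cis (real k * y i)))\<^sup>2 / real k
        \<le> 2 * (r ^ k / real k * (cmod (\<Sum>i=1..N. cis (real k * y i)))\<^sup>2)" by simp
  qed
  also have "\<dots> = 2 * (\<Sum>k=1..N. r ^ k / real k * (cmod (\<Sum>i=1..N. cis (real k * y i)))\<^sup>2)"
    by (simp only: sum_distrib_left)
  also have "\<dots> \<le> 2 * (\<Sum>i=1..N. \<Sum>j=1..N. f i j)"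
    unfolding f_def using r by (intro mult_left_mono exponential_sums_le_energy) auto
  also have "\<dots> \<le> 2 * (real N * (L + 1) + 2 * (real m)\<^sup>2 * L)" using total by simp
  finally show ?thesis by (simp add: y_def L_def)
qed

text \<open>\<open>harm n - ln n\<close> is decreasing and equals 1 at \<open>n = 1\<close>.\<close>

lemma harm_le_one_plus_ln:
  assumes "1 \<le> n"
  shows "(\<Sum>k=1..n. 1 / real k) \<le> 1 + ln (real n)"
proof -
  obtain n' where n: "n = Suc n'" using assms by (cases n) auto
  have "harm (Suc n') - ln (real (Suc n')) \<le> harm (Suc 0) - ln (real (Suc 0))"
    using decseqD[OF decseq_harm_diff_ln, of 0 n'] by simp
  moreover have "(\<Sum>k=1..n. 1 / real k) = harm n"
    by (simp add: harm_def divide_inverse)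
  ultimately show ?thesis by (simp add: n harm_Suc[of 0] harm_expand)
qed

lemma greedy_exponential_sums_l1:
  fixes m N :: nat
  assumes m: "1 \<le> m" and x: "\<And>k. 1 \<le> k \<Longrightarrow> x k \<in> {0..1}" and greedy: "greedy_from m x" and N: "2 \<le> N"
  shows "(\<Sum>k=1..N. cmod (\<Sum>i=1..N. cis (real k * (2 * pi * x i))) / real k)
      \<le> 7 * real m * (sqrt (real N) * ln (real N))"
proof -
  define l where "l = ln (real N)"
  define S where "S = (\<lambda>k. cmod (\<Sum>i=1..N. cis (real k * (2 * pi * x i))))"
  have ln2: "ln 2 \<le> l" using N by (simp add: l_def)
  \<comment> \<open>From \<open>N \<ge> 2\<close>; used to absorb additive constants into multiples
    of \<open>l\<close>.\<close>
  then have l: "1 \<le> 2 * l" using ln2_ge_two_thirds by linarith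
  have l2: "ln (2 * real N) \<le> 2 * l" using ln2 N by (simp add: l_def ln_mult)
  have ln0: "0 \<le> ln (2 * real N)" using N by simp
  have m2: "1 \<le> (real m)\<^sup>2" using m by simp
  have "(\<Sum>k=1..N. (S k)\<^sup>2 / real k) \<le> 2 * (real N * (ln (2 * real N) + 1) + 2 * (real m)\<^sup>2 * ln (2 * real N))"
    unfolding S_def by (rule greedy_exponential_sums[OF m x greedy N])
  also have "\<dots> \<le> 2 * (real N * (2 * l + 2 * l) + real N * (real m)\<^sup>2 * (2 * l))"
  proof -
    have "2 * (real m)\<^sup>2 * ln (2 * real N) \<le> real N * (real m)\<^sup>2 * (2 * l)"
      using N l l2 ln0 by (intro mult_mono) auto
    then show ?thesis using l l2 by (intro mult_left_mono add_mono mult_left_mono) auto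
  qed
  also have "\<dots> = real N * l * (8 + 4 * (real m)\<^sup>2)" by (simp add: algebra_simps)
  also have "\<dots> \<le> real N * l * (12 * (real m)\<^sup>2)"
    using m2 l N by (intro mult_left_mono) auto
  finally have E: "(\<Sum>k=1..N. (S k)\<^sup>2 / real k) \<le> real N * l * (12 * (real m)\<^sup>2)" .
  have H: "(\<Sum>k=1..N. 1 / real k) \<le> 3 * l"
    using harm_le_one_plus_ln[of N] N l by (simp add: l_def)
  \<comment> \<open>Splitting the weight \<open>1 / k\<close> evenly makes Cauchy-Schwarz produce
    the quadratic sum \<open>E\<close> and the harmonic sum \<open>H\<close>, each contributing one
    factor \<open>l\<close>.\<close>
  have "(\<Sum>k=1..N. S k / real k)\<^sup>2 = (\<Sum>k=1..N. (S k / sqrt (real k)) * (1 / sqrt (real k)))\<^sup>2"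
    by (simp add: real_sqrt_mult_self)
  also have "\<dots> \<le> (\<Sum>k=1..N. (S k / sqrt (real k))\<^sup>2) * (\<Sum>k=1..N. (1 / sqrt (real k))\<^sup>2)"
    by (rule Cauchy_Schwarz_ineq_sum)
  also have "\<dots> = (\<Sum>k=1..N. (S k)\<^sup>2 / real k) * (\<Sum>k=1..N. 1 / real k)"
    by (simp add: power_divide)
  also have "\<dots> \<le> (real N * l * (12 * (real m)\<^sup>2)) * (3 * l)"
    using E H l by (intro mult_mono sum_nonneg) auto
  also have "\<dots> = 36 * (real N * (real m)\<^sup>2 * l\<^sup>2)"
    by (simp add: power2_eq_square)
  also have "\<dots> \<le> 49 * (real N * (real m)\<^sup>2 * l\<^sup>2)"
    by (intro mult_right_mono) auto
  also have "\<dots> = (7 * real m * (sqrt (real N) * l))\<^sup>2"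
    by (simp add: power_mult_distrib)
  finally have "(\<Sum>k=1..N. S k / real k)\<^sup>2 \<le> (7 * real m * (sqrt (real N) * l))\<^sup>2" .
  then have "(\<Sum>k=1..N. S k / real k) \<le> 7 * real m * (sqrt (real N) * l)"
    by (rule power2_le_imp_le) (use l in auto)
  then show ?thesis by (simp add: S_def l_def)
qed

text \<open>Upper bounds on interval counts suffice: \<open>[0, t]\<close> bounds the counting
  function above, and \<open>[t, 1]\<close> bounds it below, since the two intervals cover all
  points.\<close>

lemma star_discrepancy_le:
  assumes N: "1 \<le> N" and x: "\<And>i. i \<in> {1..N} \<Longrightarrow> x i \<in> {0..1}"
    and bound: "\<And>a b. 0 \<le> a \<Longrightarrow> a \<le> b \<Longrightarrow> b \<le> 1 \<Longrightarrow>
      real (card {i \<in> {1..N}. x i \<in> {a..b}}) \<le> real N * (b - a) + D"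
  shows "star_discrepancy x N \<le> D / real N"
  unfolding star_discrepancy_def
proof (rule cSUP_least)
  fix t :: real assume t: "t \<in> {0..1}"
  define c where "c = real (card {i \<in> {1..N}. x i \<le> t})"
  have "{i \<in> {1..N}. x i \<in> {0..t}} = {i \<in> {1..N}. x i \<le> t}" using x by auto
  then have upper: "c \<le> real N * t + D" using bound[of 0 t] t by (simp add: c_def)
  have "{1..N} = {i \<in> {1..N}. x i \<le> t} \<union> {i \<in> {1..N}. x i \<in> {t..1}}" using x by fastforce
  then have "N \<le> card {i \<in> {1..N}. x i \<le> t} + card {i \<in> {1..N}. x i \<in> {t..1}}"
    by (metis card_Un_le card_atLeastAtMost diff_Suc_1)
  then have "real N \<le> c + real (card {i \<in> {1..N}. x i \<in> {t..1}})"
    unfolding c_def by linarith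
  then have lower: "real N * t - D \<le> c" using bound[of t 1] t by (simp add: algebra_simps)
  have "c / real N - t = (c - real N * t) / real N" using N by (simp add: field_simps)
  then have "\<bar>c / real N - t\<bar> = \<bar>c - real N * t\<bar> / real N" by (simp add: abs_divide)
  also have "\<dots> \<le> D / real N" using upper lower by (intro divide_right_mono) auto
  finally show "\<bar>real (card {i \<in> {1..N}. x i \<le> t}) / real N - t\<bar> \<le> D / real N" by (simp add: c_def)
qed simp

theorem theorem1:
  fixes m :: nat and A :: "real set"
  assumes "m \<ge> 1" and "A \<subseteq> {0..1}"
  shows "\<exists>C>0. \<forall>x :: nat \<Rightarrow> real. x ` {1..m} = A \<longrightarrow> greedy_from m x \<longrightarrow>
           (\<forall>N\<ge>2. star_discrepancy x N \<le> C * (ln (real N) / sqrt (real N)))"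
\<comment> \<open>\<open>7 * m\<close> comes from the exponential sums, 6 from the smoothing errors
  \<open>3 * s \<le> 6 * (s * l)\<close>. The initial set enters only through
  \<open>m\<close>.\<close>
proof (intro exI[of _ "7 * real m + 6"] conjI allI impI)
  fix x :: "nat \<Rightarrow> real" and N :: nat
  assume A: "x ` {1..m} = A" and greedy: "greedy_from m x" and N: "2 \<le> N"
  have x: "x k \<in> {0..1}" if "1 \<le> k" for k
  proof (cases "k \<le> m")
    case True
    then show ?thesis using A assms(2) that by (metis atLeastAtMost_iff image_eqI subsetD)
  next
    case False
    then show ?thesis using greedy by (simp add: greedy_from_def is_arg_min_def admissible_def)
  qed
  define s where "s = sqrt (real N)"
  define l where "l = ln (real N)"
  have s: "1 \<le> s" "s * s = real N" using N by (auto simp: s_def)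
  have "ln 2 \<le> l" using N by (simp add: l_def)
  then have l: "1 \<le> 2 * l" using ln2_ge_two_thirds by linarith
  have "star_discrepancy x N \<le> ((7 * real m + 6) * (s * l)) / real N"
  proof (rule star_discrepancy_le)
    fix a b :: real assume ab: "0 \<le> a" "a \<le> b" "b \<le> 1"
    \<comment> \<open>Ramp length \<open>1 / s\<close> and cutoff \<open>K = N\<close> balance the
      two smoothing errors: they become \<open>s\<close> and \<open>2 * s\<close>.\<close>
    have "real (card {i \<in> {1..N}. x i \<in> {a..b}}) \<le> real N * (b - a) + real N * (1 / s)
      + (\<Sum>k=1..N. cmod (\<Sum>i\<in>{1..N}. cis (real k * (2 * pi * x i))) / real k) + 2 * real N / (1 / s * real N)"
      using card_interval_le[of N a b "1 / s" "{1..N}" x] ab s N x by simp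
    also have "real N * (1 / s) = s" using s by (simp add: field_simps)
    also have "2 * real N / (1 / s * real N) = 2 * s" using N by simp
    also have "real N * (b - a) + s + (\<Sum>k=1..N. cmod (\<Sum>i\<in>{1..N}. cis (real k * (2 * pi * x i))) / real k) + 2 * s
        \<le> real N * (b - a) + 7 * real m * (s * l) + 3 * s"
      using greedy_exponential_sums_l1[OF assms(1) x greedy N] by (simp add: s_def l_def)
    also have "3 * s \<le> 6 * (s * l)" using mult_left_mono[OF l, of "3 * s"] s by simp
    finally show "real (card {i \<in> {1..N}. x i \<in> {a..b}}) \<le> real N * (b - a) + (7 * real m + 6) * (s * l)"
      by (simp add: algebra_simps)
  qed (use N x in auto)
  also have "\<dots> = (7 * real m + 6) * (l / s)"
    using s N by (simp add: s(2)[symmetric])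
  finally show "star_discrepancy x N \<le> (7 * real m + 6) * (ln (real N) / sqrt (real N))"
    by (simp add: s_def l_def)
qed simp

end
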